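(* Let $A$ be a real $n\times n$ matrix, let $k$ be an odd natural number, and let $\mathcal{A}$ be the matrix based tensor induced by $A$ and exponent $k$, i.e. the tensor of order $m=k+1$ and dimension $n$ with $\mathcal{A}x^{m-1}=(Ax)^{[k]}$ for all $x\in\mathbb{R}^n$. Then the following statements hold: (1) The set of all $q\in\mathbb{R}^n$ for which $\mathrm{TCP}(\mathcal{A},q)$ has a solution is closed. (2) If $A$ is an $\mathbf{R}_0$-matrix, then $\mathcal{A}$ has the $\mathbf{R}_0$-property. In this setting, $\deg(\mathcal{A})=\deg(A)$. (3) If $A$ is an $\mathbf{R}$-matrix, then $\mathcal{A}$ has the $\mathbf{R}$-property. (4) If $A$ is a $\mathbf{Q}$-matrix, then $\mathcal{A}$ has the $\mathbf{Q}$-property.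
   Context: For $y\in\mathbb{R}^n$, $y^{[k]}$ is the vector with components $(y_i)^k$. A tensor of order $m$ and dimension $n$ is an array $\mathcal{A}=[a_{i_1\cdots i_m}]$ of reals with indices in $\{1,\dots,n\}$; $\mathcal{A}x^{m-1}$ is the homogeneous polynomial map of degree $m-1$ with components $(\mathcal{A}x^{m-1})_i=\sum_{i_2,\dots,i_m} a_{ii_2\cdots i_m}x_{i_2}\cdots x_{i_m}$. All notions below depend on $\mathcal{A}$ only through $F(x):=\mathcal{A}x^{m-1}$. For a map $h:\mathbb{R}^n\to\mathbb{R}^n$ and $q\in\mathbb{R}^n$, let $\mathrm{SOL}(h,q)$ be the set of $x$ with $x\ge 0$, $h(x)+q\ge 0$ (componentwise), $\langle x,h(x)+q\rangle=0$. Put $\mathrm{SOL}(\mathcal{A},q):=\mathrm{SOL}(F,q)$, the solution set of the tensor complementarity problem $\mathrm{TCP}(\mathcal{A},q)$, and $\mathrm{SOL}(A,q):=\mathrm{SOL}(h,q)$ with $h(x)=Ax$, the solution set of the linear complementarity problem $\mathrm{LCP}(A,q)$. Let $B$ be either the matrix $A$ or the tensor $\mathcal{A}$. $B$ has the $\mathbf{R}_0$-property (is an $\mathbf{R}_0$-matrix/tensor) if $\mathrm{SOL}(B,0)=\{0\}$; it has the $\mathbf{R}$-property (is an $\mathbf{R}$-matrix/tensor) if in addition $\mathrm{SOL}(B,d)=\{0\}$ for some $d>0$ (all components positive); it has the $\mathbf{Q}$-property (is a $\mathbf{Q}$-matrix/tensor) if $\mathrm{SOL}(B,q)\ne\emptyset$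 for all $q\in\mathbb{R}^n$. Degree: for an $\mathbf{R}_0$-matrix $A$, the map $\Phi(x)=\min\{x,Ax\}$ (componentwise minimum) has $0$ as its only zero and $\deg(A):=\deg(\Phi,0)$; for an $\mathbf{R}_0$-tensor $\mathcal{A}$, $\widehat{F}(x)=\min\{x,F(x)\}$ has $0$ as its only zero and $\deg(\mathcal{A}):=\deg(\widehat{F},0)$. Here, for continuous $h$ with $h(x)=0\Leftrightarrow x=0$, $\deg(h,0)$ is the Brouwer degree of $h$ over any bounded open set containing $0$ with respect to the value $0$. *)

theory Defs
  imports "HOL-Analysis.Analysis" "HOL-Homology.Homology"
begin

section \<open>Tensors\<close>

text \<open>A tensor of order \<open>m\<close> and dimension \<open>CARD('n)\<close> is given by its entries
  \<open>\<A> [i\<^sub>1, \<dots>, i\<^sub>m]\<close>; values at lists of any other length are irrelevant.\<close>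

type_synonym 'n tensor = "'n list \<Rightarrow> real"

definition tensor_map :: "nat \<Rightarrow> 'n::finite tensor \<Rightarrow> real ^ 'n \<Rightarrow> real ^ 'n" where
  "tensor_map m \<A> x =
     (\<chi> i. \<Sum>js\<in>{js. length js = m - 1}. \<A> (i # js) * (\<Prod>j\<leftarrow>js. x $ j))"

definition cpower :: "real ^ 'n \<Rightarrow> nat \<Rightarrow> real ^ 'n" where
  "cpower y k = (\<chi> i. (y $ i) ^ k)"

text \<open>The identity below determines the polynomial map of \<open>\<A>\<close>, but determines \<open>\<A>\<close> itself only
  up to symmetrization in the last \<open>k\<close> indices.\<close>

definition matrix_based_tensor :: "real ^ 'n ^ 'n \<Rightarrow> nat \<Rightarrow> 'n::finite tensor \<Rightarrow> bool" where
  "matrix_based_tensor A k \<A> \<longleftrightarrow> (\<forall>x. tensor_map (k + 1) \<A> x = cpower (A *v x) k)"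

lemma sum_lists_prod_eq_power:
  fixes f :: "'n::finite \<Rightarrow> real"
  shows "(\<Sum>js\<in>{js. length js = k}. \<Prod>j\<leftarrow>js. f j) = (\<Sum>j\<in>UNIV. f j) ^ k"
proof (induction k)
  case 0
  then show ?case by simp
next
  case (Suc k)
  have eq: "{js::'n list. length js = Suc k} = (\<lambda>(j, js). j # js) ` (UNIV \<times> {js. length js = k})"
    by (auto simp: length_Suc_conv)
  have inj: "inj_on (\<lambda>(j, js). j # js) (UNIV \<times> {js::'n list. length js = k})"
    by (auto simp: inj_on_def)
  show ?case
    unfolding eq sum.reindex[OF inj]
    by (simp add: case_prod_unfold sum_product sum.cartesian_product flip: Suc)
qed

lemma prod_list_map_mult:
  fixes f g :: "'a \<Rightarrow> real"
  shows "(\<Prod>j\<leftarrow>js. f j) * (\<Prod>j\<leftarrow>js. g j) = (\<Prod>j\<leftarrow>js. f j * g j)"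
  by (induction js) auto

lemma matrix_based_tensor_exists:
  fixes A :: "real ^ 'n ^ 'n"
  shows "\<exists>\<A>. matrix_based_tensor A k \<A>"
proof
  show "matrix_based_tensor A k (\<lambda>is. \<Prod>j\<leftarrow>tl is. A $ hd is $ j)"
    unfolding matrix_based_tensor_def tensor_map_def cpower_def vec_eq_iff matrix_vector_mult_def
    by (simp add: prod_list_map_mult flip: sum_lists_prod_eq_power)
qed


section \<open>Complementarity problems\<close>

definition SOL :: "(real ^ 'n \<Rightarrow> real ^ 'n) \<Rightarrow> real ^ 'n \<Rightarrow> (real ^ 'n) set" where
  "SOL h q = {x. (\<forall>i. 0 \<le> x $ i) \<and> (\<forall>i. 0 \<le> (h x + q) $ i) \<and> x \<bullet> (h x + q) = 0}"

definition R0_property :: "(real ^ 'n \<Rightarrow> real ^ 'n) \<Rightarrow> bool" where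
  "R0_property h \<longleftrightarrow> SOL h 0 = {0}"

definition R_property :: "(real ^ 'n \<Rightarrow> real ^ 'n) \<Rightarrow> bool" where
  "R_property h \<longleftrightarrow> R0_property h \<and> (\<exists>d. (\<forall>i. 0 < d $ i) \<and> SOL h d = {0})"

definition Q_property :: "(real ^ 'n \<Rightarrow> real ^ 'n) \<Rightarrow> bool" where
  "Q_property h \<longleftrightarrow> (\<forall>q. SOL h q \<noteq> {})"

abbreviation LCP_SOL :: "real ^ 'n ^ 'n \<Rightarrow> real ^ 'n \<Rightarrow> (real ^ 'n) set" where
  "LCP_SOL A q \<equiv> SOL (\<lambda>x. A *v x) q"

abbreviation TCP_SOL :: "nat \<Rightarrow> 'n::finite tensor \<Rightarrow> real ^ 'n \<Rightarrow> (real ^ 'n) set" where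
  "TCP_SOL m \<A> q \<equiv> SOL (tensor_map m \<A>) q"

abbreviation R0_matrix :: "real ^ 'n ^ 'n \<Rightarrow> bool" where
  "R0_matrix A \<equiv> R0_property (\<lambda>x. A *v x)"

abbreviation R_matrix :: "real ^ 'n ^ 'n \<Rightarrow> bool" where
  "R_matrix A \<equiv> R_property (\<lambda>x. A *v x)"

abbreviation Q_matrix :: "real ^ 'n ^ 'n \<Rightarrow> bool" where
  "Q_matrix A \<equiv> Q_property (\<lambda>x. A *v x)"

abbreviation R0_tensor :: "nat \<Rightarrow> 'n::finite tensor \<Rightarrow> bool" where
  "R0_tensor m \<A> \<equiv> R0_property (tensor_map m \<A>)"

abbreviation R_tensor :: "nat \<Rightarrow> 'n::finite tensor \<Rightarrow> bool" where
  "R_tensor m \<A> \<equiv> R_property (tensor_map m \<A>)"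

abbreviation Q_tensor :: "nat \<Rightarrow> 'n::finite tensor \<Rightarrow> bool" where
  "Q_tensor m \<A> \<equiv> Q_property (tensor_map m \<A>)"


section \<open>Brouwer degree\<close>

text \<open>
  The degree \<open>deg(h, \<Omega>, p)\<close> of a map \<open>h\<close>, continuous on the closure of a bounded open set \<open>\<Omega>\<close>
  and with \<open>p\<close> not in the image of the boundary of \<open>\<Omega>\<close>, in its homological form (Dold, Lectures on
  Algebraic Topology, IV.5 and VIII.4). Let \<open>n\<close> be the dimension of the space \<open>E\<close>, let \<open>K\<close> be the
  compact set of \<open>p\<close>-points of \<open>h\<close> in \<open>\<Omega>\<close>, and let \<open>B\<close> be a closed ball about \<open>0\<close> that contains
  \<open>\<Omega>\<close> and \<open>p\<close>. In
  \<open>H\<^sub>n(E, E - B) \<rightarrow> H\<^sub>n(E, E - K) \<leftarrow> H\<^sub>n(\<Omega>, \<Omega> - K) \<rightarrow> H\<^sub>n(E, E - {p})\<close>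
  the first two maps are induced by inclusions and the last one by \<open>h\<close>; the second is an excision
  isomorphism. The inclusion also induces an isomorphism \<open>H\<^sub>n(E, E - B) \<rightarrow> H\<^sub>n(E, E - {p})\<close> of
  infinite cyclic groups, and the degree is the integer by which the displayed composite differs
  from it. Since a class and its image occur on both sides, no orientation has to be chosen. The
  groups are written multiplicatively, so that an integer multiple is a power.
\<close>

definition brouwer_degree :: "('a::euclidean_space \<Rightarrow> 'a) \<Rightarrow> 'a set \<Rightarrow> 'a \<Rightarrow> int" where
  "brouwer_degree h \<Omega> p =
    (let n = int DIM('a); E = (euclidean :: 'a topology); K = {x \<in> \<Omega>. h x = p};
         U = top_of_set \<Omega>
     in THE d. \<forall>r. insert p \<Omega> \<subseteq> cball 0 r \<longrightarrow>
          (\<forall>a \<in> carrier (relative_homology_group n E (- cball 0 r)).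
           \<forall>c \<in> carrier (relative_homology_group n U (\<Omega> - K)).
             hom_induced n U (\<Omega> - K) E (- K) id c = hom_induced n E (- cball 0 r) E (- K) id a \<longrightarrow>
             hom_induced n U (\<Omega> - K) E (- {p}) h c =
               hom_induced n E (- cball 0 r) E (- {p}) id a
                 [^]\<^bsub>relative_homology_group n E (- {p})\<^esub> d))"

text \<open>For continuous \<open>h\<close> whose only zero is \<open>0\<close>, the degree with respect to the value \<open>0\<close> is the same
  over all bounded open sets containing \<open>0\<close> (excision); this common value is the degree of \<open>h\<close> at \<open>0\<close>.\<close>

definition degree_at_zero :: "('a::euclidean_space \<Rightarrow> 'a) \<Rightarrow> int" where
  "degree_at_zero h =
     (THE d. \<forall>\<Omega>. open \<Omega> \<and> bounded \<Omega> \<and> 0 \<in> \<Omega> \<longrightarrow> brouwer_degree h \<Omega> 0 = d)"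

definition min_map :: "(real ^ 'n \<Rightarrow> real ^ 'n) \<Rightarrow> real ^ 'n \<Rightarrow> real ^ 'n" where
  "min_map h x = (\<chi> i. min (x $ i) (h x $ i))"

definition matrix_degree :: "real ^ 'n ^ 'n \<Rightarrow> int" where
  "matrix_degree A = degree_at_zero (min_map (\<lambda>x. A *v x))"

definition tensor_degree :: "nat \<Rightarrow> 'n::finite tensor \<Rightarrow> int" where
  "tensor_degree m \<A> = degree_at_zero (min_map (tensor_map m \<A>))"

end

theory Submission
  imports Defs
begin

text \<open>
  Since \<open>k\<close> is odd, \<open>u\<^sup>k + q \<ge> 0\<close> holds iff \<open>u + root k q \<ge> 0\<close>, and likewise for equality. Hence the
  tensor problem with data \<open>q\<close> has exactly the solutions of the linear one with the componentwise
  \<open>k\<close>-th root of \<open>q\<close>, which reduces everything but the degree to facts about \<open>A\<close>. The data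
  for which the linear problem is solvable form a finite union of finitely generated cones, one
  for each choice of the coordinates in which \<open>x\<close> vanishes. For the degree, \<open>(1 - t) u + t u\<^sup>k\<close>
  has the sign of \<open>u\<close>, so the zeros of \<open>min {x, (1 - t) A x + t (A x)\<^sup>[\<^sup>k\<^sup>]}\<close> do not depend on \<open>t\<close>.
\<close>

text \<open>A vanishing sum of nonnegative products vanishes termwise, so complementarity splits
  into coordinates.\<close>

lemma mem_SOL_iff:
  "x \<in> SOL h q \<longleftrightarrow>
    (\<forall>i. 0 \<le> x $ i \<and> 0 \<le> h x $ i + q $ i \<and> (x $ i = 0 \<or> h x $ i + q $ i = 0))"
proof -
  have "x \<bullet> (h x + q) = 0 \<longleftrightarrow> (\<forall>i. x $ i * (h x $ i + q $ i) = 0)"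
    if "\<forall>i. 0 \<le> x $ i" "\<forall>i. 0 \<le> h x $ i + q $ i"
    using that by (simp add: inner_vec_def sum_nonneg_eq_0_iff)
  then show ?thesis
    unfolding SOL_def by auto
qed

lemma min_map_eq_0_iff: "min_map h x = 0 \<longleftrightarrow> x \<in> SOL h 0"
  unfolding mem_SOL_iff min_map_def vec_eq_iff min_def
  by (auto split: if_splits) (metis order.antisym linorder_linear)+

lemma odd_power_add_root:
  fixes u q :: real
  assumes "odd k"
  shows "0 \<le> u ^ k + q \<longleftrightarrow> 0 \<le> u + root k q" and "u ^ k + q = 0 \<longleftrightarrow> u + root k q = 0"
proof -
  have k: "k > 0" using assms by (auto intro: Nat.gr0I)
  have "- q \<le> u ^ k \<longleftrightarrow> - root k q \<le> u"
    using real_root_le_iff[OF k, of "- q" "u ^ k"] odd_real_root_power_cancel[OF assms, of u]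
    by (simp add: real_root_minus)
  then show "0 \<le> u ^ k + q \<longleftrightarrow> 0 \<le> u + root k q" by linarith
  have "u ^ k = - q \<longleftrightarrow> u = - root k q"
    using real_root_eq_iff[OF k, of "u ^ k" "- q"] odd_real_root_power_cancel[OF assms, of u]
    by (simp add: real_root_minus)
  then show "u ^ k + q = 0 \<longleftrightarrow> u + root k q = 0" by linarith
qed

lemma SOL_cpower:
  assumes "odd k"
  shows "SOL (\<lambda>x. cpower (h x) k) q = SOL h (\<chi> i. root k (q $ i))"
  using assms by (auto simp: mem_SOL_iff cpower_def odd_power_add_root)

lemma sum_in_convex_cone_hull:
  assumes "\<And>i. i \<in> I \<Longrightarrow> f i \<in> convex_cone hull S"
  shows "sum f I \<in> convex_cone hull S"
  using assms
  by (induction I rule: infinite_finite_induct)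
    (auto intro: convex_cone_hull_add convex_cone_hull_contains_0)

text \<open>With \<open>w = A *v x + q\<close> one has \<open>q = w - A *v x\<close>, and
  complementarity leaves each index either a unit vector or a negated column. These are the
  complementary cones of \<open>A\<close>.\<close>

lemma LCP_SOL_nonempty_eq_UN_cones:
  fixes A :: "real ^ 'n ^ 'n"
  shows "{q. LCP_SOL A q \<noteq> {}} =
    (\<Union>I. convex_cone hull range (\<lambda>i. if i \<in> I then - column i A else axis i 1))"
    (is "?S = (\<Union>I. convex_cone hull ?G I)")
proof (intro equalityI subsetI)
  fix q assume "q \<in> ?S"
  then obtain x where x: "x \<in> LCP_SOL A q" by auto
  \<comment> \<open>Off \<open>I\<close> the slack is positive, which forces
    \<open>x $ i = 0\<close>. An index where both vanish lies in \<open>I\<close> and gets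
    coefficient 0.\<close>
  define I where "I = {i. (A *v x) $ i + q $ i = 0}"
  define c where "c i = (if i \<in> I then x $ i else (A *v x + q) $ i)" for i
  have c: "c i \<ge> 0" "i \<notin> I \<Longrightarrow> x $ i = 0" for i
    using x unfolding mem_SOL_iff c_def I_def by auto
  have "(\<Sum>i\<in>UNIV. c i *\<^sub>R (if i \<in> I then - column i A else axis i 1)) =
      (\<Sum>i\<in>UNIV. (A *v x + q) $ i *\<^sub>R axis i 1 - x $ i *\<^sub>R column i A)"
    by (rule sum.cong) (use c(2) in \<open>auto simp: c_def I_def\<close>)
  also have "\<dots> = (A *v x + q) - A *v x"
    using basis_expansion[of "A *v x + q"]
    by (simp add: sum_subtractf matrix_mult_sum scalar_mult_eq_scaleR)
  finally have "q = (\<Sum>i\<in>UNIV. c i *\<^sub>R (if i \<in> I then - column i A else axis i 1))"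
    by simp
  moreover have "c i *\<^sub>R (if i \<in> I then - column i A else axis i 1) \<in> convex_cone hull ?G I" for i
    by (intro convex_cone_hull_mul hull_inc c rangeI)
  ultimately have "q \<in> convex_cone hull ?G I"
    by (simp only: sum_in_convex_cone_hull)
  then show "q \<in> (\<Union>I. convex_cone hull ?G I)" by blast
next
  fix q assume "q \<in> (\<Union>I. convex_cone hull ?G I)"
  then obtain I where I: "q \<in> convex_cone hull ?G I" by blast
  \<comment> \<open>Prescribing through \<open>I\<close> which factor vanishes replaces the
    disjunction in \<open>mem_SOL_iff\<close> by homogeneous linear conditions on \<open>x\<close>
    and \<open>q\<close> jointly, so the admissible \<open>q\<close> form a convex cone.\<close>
  define P where "P x q \<longleftrightarrow> (\<forall>i. 0 \<le> x $ i \<and> 0 \<le> (A *v x) $ i + q $ i \<and>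
    (if i \<in> I then (A *v x) $ i + q $ i = 0 else x $ i = 0))" for x q
  have "convex_cone {q. \<exists>x. P x q}"
    unfolding convex_cone_iff
  proof (intro conjI ballI allI impI; clarsimp)
    show "\<exists>x. P x 0"
      by (rule exI[of _ 0]) (simp add: P_def)
  next
    fix p q x y assume "P x p" "P y q"
    have "P (x + y) (p + q)"
      unfolding P_def
    proof
      fix i
      have "(A *v (x + y)) $ i + (p + q) $ i = ((A *v x) $ i + p $ i) + ((A *v y) $ i + q $ i)"
        by (simp add: matrix_vector_right_distrib)
      then show "0 \<le> (x + y) $ i \<and> 0 \<le> (A *v (x + y)) $ i + (p + q) $ i \<and>
          (if i \<in> I then (A *v (x + y)) $ i + (p + q) $ i = 0 else (x + y) $ i = 0)"
        using \<open>P x p\<close>[unfolded P_def, THEN spec, of i] \<open>P y q\<close>[unfolded P_def, THEN spec, of i]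
        by auto
    qed
    then show "\<exists>x. P x (p + q)" ..
  next
    fix q x and c :: real assume "0 \<le> c" "P x q"
    have "P (c *\<^sub>R x) (c *\<^sub>R q)"
      unfolding P_def
    proof
      fix i
      have "(A *v (c *\<^sub>R x)) $ i + (c *\<^sub>R q) $ i = c * ((A *v x) $ i + q $ i)"
        by (simp add: matrix_vector_mult_scaleR algebra_simps)
      then show "0 \<le> (c *\<^sub>R x) $ i \<and> 0 \<le> (A *v (c *\<^sub>R x)) $ i + (c *\<^sub>R q) $ i \<and>
          (if i \<in> I then (A *v (c *\<^sub>R x)) $ i + (c *\<^sub>R q) $ i = 0 else (c *\<^sub>R x) $ i = 0)"
        using \<open>0 \<le> c\<close> \<open>P x q\<close>[unfolded P_def, THEN spec, of i] by auto
    qed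
    then show "\<exists>x. P x (c *\<^sub>R q)" ..
  qed
  moreover have "?G I \<subseteq> {q. \<exists>x. P x q}"
  proof clarify
    fix i
    \<comment> \<open>The point \<open>axis i 1\<close> cancels \<open>- column i A\<close> exactly;
      for the generator \<open>axis i 1\<close> the point 0 leaves a slack supported off
      \<open>I\<close>.\<close>
    have "P (if i \<in> I then axis i 1 else 0) (if i \<in> I then - column i A else axis i 1)"
      by (simp add: P_def matrix_vector_mult_basis) (auto simp: axis_def)
    then show "\<exists>x. P x (if i \<in> I then - column i A else axis i 1)" ..
  qed
  ultimately obtain x where "P x q"
    using I hull_minimal[of "?G I" "{q. \<exists>x. P x q}" convex_cone] by blast
  then have "x \<in> LCP_SOL A q"
    unfolding mem_SOL_iff P_def by meson
  then show "q \<in> ?S" by blast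
qed

text \<open>There are finitely many index sets, and a cone generated by a finite set is
  closed.\<close>

lemma closed_LCP_SOL_nonempty:
  fixes A :: "real ^ 'n ^ 'n"
  shows "closed {q. LCP_SOL A q \<noteq> {}}"
  unfolding LCP_SOL_nonempty_eq_UN_cones
  by (intro closed_UN) (auto intro: closed_convex_cone_hull)

text \<open>The map enters the definition only through its \<open>p\<close>-points and its induced
  homomorphism. The former agree by assumption, the latter by homotopy invariance for pairs, so both
  descriptions under \<open>THE\<close> coincide.\<close>

lemma brouwer_degree_homotopic:
  assumes "{x \<in> \<Omega>. f x = p} = {x \<in> \<Omega>. g x = p}"
    and "homotopic_with (\<lambda>h. h \<in> (\<Omega> - {x \<in> \<Omega>. f x = p}) \<rightarrow> - {p}) (top_of_set \<Omega>) euclidean f g"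
  shows "brouwer_degree f \<Omega> p = brouwer_degree g \<Omega> p"
  unfolding brouwer_degree_def Let_def
  using homology_homotopy_axiom[OF assms(2)] by (simp add: assms(1))

text \<open>\<open>H\<close> restricted to any set is itself a homotopy of pairs, because no stage
  acquires a zero away from 0.\<close>

lemma degree_at_zero_homotopic:
  fixes H :: "real \<times> 'a::euclidean_space \<Rightarrow> 'a"
  assumes "continuous_on ({0..1} \<times> UNIV) H"
    and "\<And>t x. t \<in> {0..1} \<Longrightarrow> H (t, x) = 0 \<longleftrightarrow> x = 0"
  shows "degree_at_zero (\<lambda>x. H (0, x)) = degree_at_zero (\<lambda>x. H (1, x))"
proof -
  have "brouwer_degree (\<lambda>x. H (0, x)) \<Omega> 0 = brouwer_degree (\<lambda>x. H (1, x)) \<Omega> 0" for \<Omega>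
  proof (rule brouwer_degree_homotopic)
    show "{x \<in> \<Omega>. H (0, x) = 0} = {x \<in> \<Omega>. H (1, x) = 0}"
      using assms(2) by auto
    have "continuous_on ({0..1} \<times> \<Omega>) H"
      using assms(1) continuous_on_subset by blast
    then show "homotopic_with (\<lambda>h. h \<in> (\<Omega> - {x \<in> \<Omega>. H (0, x) = 0}) \<rightarrow> - {0}) (top_of_set \<Omega>) euclidean
        (\<lambda>x. H (0, x)) (\<lambda>x. H (1, x))"
      unfolding homotopic_with_def
      by (intro exI[of _ H])
        (use assms(2) in \<open>auto simp: Pi_iff simp flip: subtopology_Times\<close>)
  qed
  then show ?thesis
    unfolding degree_at_zero_def by simp
qed

lemma degree_min_map_cpower:
  fixes h :: "real ^ 'n \<Rightarrow> real ^ 'n"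
  assumes "odd k" and "continuous_on UNIV h" and "R0_property h"
  shows "degree_at_zero (min_map (\<lambda>x. cpower (h x) k)) = degree_at_zero (min_map h)"
proof -
  \<comment> \<open>Interpolating inside the minimum keeps every stage a \<open>min_map\<close>,
    whose zeros are \<open>SOL (G t) 0\<close>.\<close>
  define G where "G t x = (1 - t) *\<^sub>R h x + t *\<^sub>R cpower (h x) k" for t and x :: "real ^ 'n"
  define H where "H z = min_map (G (fst z)) (snd z)" for z
  have pos: "0 \<le> (1 - t) * u + t * u ^ k \<longleftrightarrow> 0 \<le> u" and
    zero: "(1 - t) * u + t * u ^ k = 0 \<longleftrightarrow> u = 0"
    if "t \<in> {0..1}" for t u :: real
  proof -
    \<comment> \<open>This even power appears in the cofactor left when \<open>u\<close> is factored
      out of the interpolation. The cofactor is positive for nonzero \<open>u\<close>, even at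
      \<open>t = 1\<close>, where \<open>1 - t\<close> contributes nothing.\<close>
    have v: "0 \<le> u ^ (k - 1)" "u \<noteq> 0 \<Longrightarrow> 0 < u ^ (k - 1)"
      using assms(1) by (auto simp: zero_le_even_power zero_less_power_eq)
    have "0 \<le> (1 - t) + t * u ^ (k - 1)"
      using that v(1) by simp
    moreover have "0 < (1 - t) + t * u ^ (k - 1)" if "u \<noteq> 0"
      using \<open>t \<in> {0..1}\<close> v(2)[OF that] by (cases "t = 1") (auto intro: add_pos_nonneg)
    moreover have "(1 - t) * u + t * u ^ k = u * ((1 - t) + t * u ^ (k - 1))"
      using assms(1) by (cases k) (auto simp: algebra_simps)
    ultimately show "0 \<le> (1 - t) * u + t * u ^ k \<longleftrightarrow> 0 \<le> u"
      "(1 - t) * u + t * u ^ k = 0 \<longleftrightarrow> u = 0"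
      by (auto simp: zero_le_mult_iff less_le)
  qed
  have "continuous_on UNIV H"
    unfolding H_def G_def min_map_def cpower_def
    by (auto intro!: continuous_intros continuous_on_compose2[OF assms(2)])
  moreover have "H (t, x) = 0 \<longleftrightarrow> x = 0" if "t \<in> {0..1}" for t x
  proof -
    have "SOL (G t) 0 = SOL h 0"
      by (auto simp: mem_SOL_iff G_def cpower_def pos[OF that] zero[OF that])
    then show ?thesis
      using assms(3) by (simp add: H_def min_map_eq_0_iff R0_property_def)
  qed
  ultimately have "degree_at_zero (\<lambda>x. H (0, x)) = degree_at_zero (\<lambda>x. H (1, x))"
    by (intro degree_at_zero_homotopic) (auto intro: continuous_on_subset)
  then show ?thesis
    by (simp add: H_def G_def[abs_def])
qed

theorem proposition4p2:
  fixes A :: "real ^ 'n ^ 'n" and k :: nat and \<A> :: "'n tensor"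
  assumes "odd k" and "matrix_based_tensor A k \<A>"
  shows "closed {q. TCP_SOL (k + 1) \<A> q \<noteq> {}} \<and>
    (R0_matrix A \<longrightarrow> R0_tensor (k + 1) \<A> \<and> tensor_degree (k + 1) \<A> = matrix_degree A) \<and>
    (R_matrix A \<longrightarrow> R_tensor (k + 1) \<A>) \<and>
    (Q_matrix A \<longrightarrow> Q_tensor (k + 1) \<A>)"
proof -
  define r where "r q = (\<chi> i. root k (q $ i))" for q :: "real ^ 'n"
  have F: "tensor_map (k + 1) \<A> = (\<lambda>x. cpower (A *v x) k)"
    using assms(2) by (auto simp: matrix_based_tensor_def)
  have SOL: "TCP_SOL (k + 1) \<A> q = LCP_SOL A (r q)" for q
    unfolding F r_def by (rule SOL_cpower[OF assms(1)])
  have r0: "r 0 = 0"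
    by (simp add: r_def vec_eq_iff)
  have "continuous_on UNIV r"
    unfolding r_def by (intro continuous_intros)
  \<comment> \<open>The solvable data of the tensor problem are the preimage under \<open>r\<close>
    of those of the linear problem.\<close>
  then have "closed (r -` {q. LCP_SOL A q \<noteq> {}})"
    using closed_LCP_SOL_nonempty by (rule closed_vimage[rotated])
  then have 1: "closed {q. TCP_SOL (k + 1) \<A> q \<noteq> {}}"
    by (simp only: SOL vimage_def mem_Collect_eq)
  have R0: "R0_tensor (k + 1) \<A> \<longleftrightarrow> R0_matrix A"
    unfolding R0_property_def SOL r0 ..
  have 2: "tensor_degree (k + 1) \<A> = matrix_degree A" if "R0_matrix A"
    unfolding tensor_degree_def matrix_degree_def F
    by (rule degree_min_map_cpower[OF assms(1) _ that])
      (intro linear_continuous_on matrix_vector_mul_bounded_linear)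
  have 3: "R_tensor (k + 1) \<A>" if "R_matrix A"
  proof -
    obtain d where d: "\<forall>i. 0 < d $ i" "LCP_SOL A d = {0}"
      using \<open>R_matrix A\<close> by (auto simp: R_property_def)
    \<comment> \<open>The power of \<open>d\<close> is positive like \<open>d\<close>, and
      \<open>r\<close> carries it back to \<open>d\<close>.\<close>
    have "r (cpower d k) = d"
      using assms(1) by (simp add: r_def cpower_def vec_eq_iff odd_real_root_power_cancel)
    then have "TCP_SOL (k + 1) \<A> (cpower d k) = {0}" and "\<forall>i. 0 < cpower d k $ i"
      using d SOL[of "cpower d k"] by (simp_all add: cpower_def)
    then show ?thesis
      using that R0 unfolding R_property_def by blast
  qed
  have 4: "Q_tensor (k + 1) \<A>" if "Q_matrix A"
    using that by (simp only: Q_property_def SOL simp_thms)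
  show ?thesis
    using 1 2 3 4 R0 by blast
qed

end
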